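(* Let $\mathbb{A}$ be a unital $C^{\ast}$-algebra with unit $I$, let $(\mathcal{U},\mathbb{A},d)$ be a complete $C^{\ast}$-algebra-valued metric space, and let $T:\mathcal{U}\to\mathcal{U}$ satisfy $$d(Tx,Ty)\preceq \tau\, d(x,y)^{\alpha}\,d(x,Tx)^{\beta}\,d(y,Ty)^{\eta}$$ for all $x,y\in\mathcal{U}$ with $x\neq Tx$ and $y\neq Ty$, where $\tau\in(0,1)$ and $\alpha,\beta,\eta\in(0,1)$ are such that $\alpha+\beta+\eta>1$. If there exists $x_0\in\mathcal{U}$ such that $d(x_0,Tx_0)\preceq I$, then $T$ has a fixed point in $\mathcal{U}$.
   Context: $\mathbb{A}$ is a unital $C^{\ast}$-algebra with unit $I$ and zero element $\theta$. Let $\mathbb{A}_h=\{x\in\mathbb{A}:x=x^{\ast}\}$. An element $x$ is positive, written $x\succeq\theta$, if $x\in\mathbb{A}_h$ and its spectrum satisfies $\sigma(x)\subset\mathbb{R}_+=[0,\infty)$; $\mathbb{A}_+$ is the set of positive elements. The relation $x\preceq y$ means $y-x\succeq\theta$. For $a\in\mathbb{A}_+$ and real $s>0$, $a^s\in\mathbb{A}_+$ is defined by the continuous functional calculus. A $C^{\ast}$-algebra-valued metric space $(\mathcal{U},\mathbb{A},d)$ is a non-empty set $\mathcal{U}$ with a map $d:\mathcal{U}\times\mathcal{U}\to\mathbb{A}_+$ such that (i) $d(x,y)=\theta$ if and only if $x=y$; (ii) $d(x,y)=d(y,x)$ for all $x,y$; (iii) $d(x,y)\preceq d(x,u)+d(u,y)$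 for all $x,y,u$. A sequence $(x_n)$ converges to $z$ if $\|d(x_n,z)\|\to 0$; it is Cauchy if $\|d(x_n,x_m)\|\to 0$ as $n,m\to\infty$; the space is complete if every Cauchy sequence converges to a point of $\mathcal{U}$. *)

theory Defs
  imports "HOL-Analysis.Analysis"
begin

text \<open>
  The library provides no complex Banach algebras, so the complex scalar multiplication is
  part of the class; it is tied to the library's real structure by \<open>scaleR_eq_scaleC\<close>.
  Through \<^class>\<open>real_normed_algebra_1\<close> the unit is nonzero and has norm one.
\<close>

class cstar_algebra = real_normed_algebra_1 + banach +
  fixes scaleC :: "complex \<Rightarrow> 'a \<Rightarrow> 'a"  (infixr \<open>*\<^sub>C\<close> 75)
    and star :: "'a \<Rightarrow> 'a"
  assumes scaleC_add_right: "c *\<^sub>C (x + y) = c *\<^sub>C x + c *\<^sub>C y"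
    and scaleC_add_left: "(b + c) *\<^sub>C x = b *\<^sub>C x + c *\<^sub>C x"
    and scaleC_scaleC: "b *\<^sub>C c *\<^sub>C x = (b * c) *\<^sub>C x"
    and scaleR_eq_scaleC: "r *\<^sub>R x = complex_of_real r *\<^sub>C x"
    and mult_scaleC_left: "(c *\<^sub>C x) * y = c *\<^sub>C (x * y)"
    and mult_scaleC_right: "x * (c *\<^sub>C y) = c *\<^sub>C (x * y)"
    and norm_scaleC: "norm (c *\<^sub>C x) = cmod c * norm x"
    and star_star: "star (star x) = x"
    and star_add: "star (x + y) = star x + star y"
    and star_scaleC: "star (c *\<^sub>C x) = cnj c *\<^sub>C star x"
    and star_mult: "star (x * y) = star y * star x"
    and cstar_identity: "norm (star x * x) = (norm x)\<^sup>2"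

definition selfadjoint :: "'a::cstar_algebra \<Rightarrow> bool" where
  "selfadjoint x \<longleftrightarrow> star x = x"

definition cstar_spectrum :: "'a::cstar_algebra \<Rightarrow> complex set" where
  "cstar_spectrum x =
    {c. \<not> (\<exists>y. (c *\<^sub>C 1 - x) * y = 1 \<and> y * (c *\<^sub>C 1 - x) = 1)}"

definition cstar_positive :: "'a::cstar_algebra \<Rightarrow> bool" where
  "cstar_positive x \<longleftrightarrow> selfadjoint x \<and> cstar_spectrum x \<subseteq> \<real>\<^sub>\<ge>\<^sub>0"

definition cstar_le :: "'a::cstar_algebra \<Rightarrow> 'a \<Rightarrow> bool"  (infix \<open>\<preceq>\<close> 50) where
  "x \<preceq> y \<longleftrightarrow> cstar_positive (y - x)"

text \<open>
  \<open>is_cfc a \<Phi>\<close>: \<open>\<Phi>\<close> is an isometric unital *-homomorphism from the continuous functions on the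
  spectrum of \<open>a\<close> into the algebra that maps the identity function to \<open>a\<close>. Elements of
  \<open>C(\<sigma>(a))\<close> are represented by total functions continuous on \<open>\<sigma>(a)\<close>, identified when they
  agree on \<open>\<sigma>(a)\<close>. For normal \<open>a\<close> such a \<open>\<Phi>\<close> exists and is unique on these functions.
\<close>

definition is_cfc :: "'a::cstar_algebra \<Rightarrow> ((complex \<Rightarrow> complex) \<Rightarrow> 'a) \<Rightarrow> bool" where
  "is_cfc a \<Phi> \<longleftrightarrow>
    (let C = {f. continuous_on (cstar_spectrum a) f} in
      (\<forall>f\<in>C. \<forall>g\<in>C. (\<forall>z\<in>cstar_spectrum a. f z = g z) \<longrightarrow> \<Phi> f = \<Phi> g) \<and>
      (\<forall>f\<in>C. \<forall>g\<in>C. \<Phi> (\<lambda>z. f z + g z) = \<Phi> f + \<Phi> g) \<and>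
      (\<forall>f\<in>C. \<forall>g\<in>C. \<Phi> (\<lambda>z. f z * g z) = \<Phi> f * \<Phi> g) \<and>
      (\<forall>c. \<forall>f\<in>C. \<Phi> (\<lambda>z. c * f z) = c *\<^sub>C \<Phi> f) \<and>
      (\<forall>f\<in>C. \<Phi> (\<lambda>z. cnj (f z)) = star (\<Phi> f)) \<and>
      (\<forall>f\<in>C. norm (\<Phi> f) = (SUP z\<in>cstar_spectrum a. cmod (f z))) \<and>
      \<Phi> (\<lambda>z. 1) = 1 \<and>
      \<Phi> (\<lambda>z. z) = a)"

definition cfc :: "'a::cstar_algebra \<Rightarrow> (complex \<Rightarrow> complex) \<Rightarrow> 'a" where
  "cfc a f = (THE y. \<exists>\<Phi>. is_cfc a \<Phi> \<and> \<Phi> f = y)"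

text \<open>Only used for positive \<open>a\<close> and \<open>s > 0\<close>, where \<open>Re z = z\<close> on the spectrum of \<open>a\<close>.\<close>

definition cstar_powr :: "'a::cstar_algebra \<Rightarrow> real \<Rightarrow> 'a"  (infixr \<open>cpowr\<close> 80) where
  "a cpowr s = cfc a (\<lambda>z. complex_of_real (Re z powr s))"

locale cstar_metric_space =
  fixes U :: "'u set" and d :: "'u \<Rightarrow> 'u \<Rightarrow> 'a::cstar_algebra"
  assumes nonempty: "U \<noteq> {}"
    and positive: "\<lbrakk>x \<in> U; y \<in> U\<rbrakk> \<Longrightarrow> cstar_positive (d x y)"
    and zero_iff: "\<lbrakk>x \<in> U; y \<in> U\<rbrakk> \<Longrightarrow> d x y = 0 \<longleftrightarrow> x = y"
    and commute: "\<lbrakk>x \<in> U; y \<in> U\<rbrakk> \<Longrightarrow> d x y = d y x"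
    and triangle: "\<lbrakk>x \<in> U; y \<in> U; u \<in> U\<rbrakk> \<Longrightarrow> d x y \<preceq> d x u + d u y"
begin

definition converges_to :: "(nat \<Rightarrow> 'u) \<Rightarrow> 'u \<Rightarrow> bool" where
  "converges_to X z \<longleftrightarrow> (\<lambda>n. norm (d (X n) z)) \<longlonglongrightarrow> 0"

definition cauchy_seq :: "(nat \<Rightarrow> 'u) \<Rightarrow> bool" where
  "cauchy_seq X \<longleftrightarrow> ((\<lambda>(n, m). norm (d (X n) (X m))) \<longlongrightarrow> 0) (sequentially \<times>\<^sub>F sequentially)"

end

locale complete_cstar_metric_space = cstar_metric_space +
  assumes complete: "\<lbrakk>range X \<subseteq> U; cauchy_seq X\<rbrakk> \<Longrightarrow> \<exists>z\<in>U. converges_to X z"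

end

theory Submission
  imports Defs "HOL-Computational_Algebra.Fundamental_Theorem_Algebra"
begin

text \<open>
  The theorem reduces to real numbers: \<open>\<rho> x y = norm (d x y)\<close> is a complete metric, and
  taking norms in the hypothesis gives
  \<open>\<rho> (T x) (T y) \<le> \<tau> * \<rho> x y powr \<alpha> * \<rho> x (T x) powr \<beta> * \<rho> y (T y) powr \<eta>\<close>. For such a map
  the orbit of a point with displacement at most \<open>1\<close> has geometrically decreasing displacements,
  because \<open>\<alpha> + \<beta> > 1 - \<eta>\<close>, and its limit is a fixed point
  (\<open>fixed_point_of_power_contraction\<close>).

  Two facts about \<open>C\<^sup>*\<close>-algebras justify the reduction. The norm is monotone on positive elements
  (\<open>norm_mono_of_cstar_le\<close>), which yields the triangle inequality for \<open>\<rho>\<close> and the passage to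
  norms. The power of a positive element satisfies \<open>norm (a cpowr s) \<le> norm a powr s\<close>
  (\<open>norm_cpowr_le\<close>). Powers are defined through a definite description, so this
  bound requires that the continuous functional calculus exists and is unique.

  Both rest on the fact that a self-adjoint element has a spectral value of modulus equal to its
  norm (\<open>norm_attained_on_spectrum\<close>), proved here by averaging resolvents over roots of unity.
  Together with the spectral mapping theorem for polynomials it makes polynomial evaluation at a
  self-adjoint \<open>a\<close> an isometry for the supremum norm on the spectrum of \<open>a\<close>. Since the spectrum is
  a compact set of real numbers, polynomials are dense in its continuous functions, and the
  calculus is the unique continuous extension of evaluation.
\<close>

section \<open>Scalars, involution and norm\<close>

lemma scaleC_zero_left [simp]: "0 *\<^sub>C (x::'a::cstar_algebra) = 0"
  using scaleC_add_left[of 0 0 x] by simp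

lemma scaleC_zero_right [simp]: "c *\<^sub>C (0::'a::cstar_algebra) = 0"
  using scaleC_add_right[of c 0 "0::'a"] by simp

lemma scaleC_one [simp]: "1 *\<^sub>C (x::'a::cstar_algebra) = x"
  using scaleR_eq_scaleC[of 1 x] by simp

lemma scaleC_minus_left [simp]: "(- c) *\<^sub>C (x::'a::cstar_algebra) = - (c *\<^sub>C x)"
  using scaleC_add_left[of c "-c" x] by (simp add: add_eq_0_iff)

lemma scaleC_minus_right [simp]: "c *\<^sub>C (- x::'a::cstar_algebra) = - (c *\<^sub>C x)"
  using scaleC_add_right[of c x "-x"] by (simp add: add_eq_0_iff)

lemma scaleC_diff_left: "(b - c) *\<^sub>C (x::'a::cstar_algebra) = b *\<^sub>C x - c *\<^sub>C x"
  using scaleC_add_left[of b "-c" x] by simp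

lemma scaleC_diff_right: "c *\<^sub>C (x - y::'a::cstar_algebra) = c *\<^sub>C x - c *\<^sub>C y"
  using scaleC_add_right[of c x "-y"] by simp

lemma star_zero [simp]: "star (0::'a::cstar_algebra) = 0"
  using star_add[of 0 "0::'a"] by simp

lemma star_one [simp]: "star (1::'a::cstar_algebra) = 1"
  using star_mult[of "star (1::'a)" 1] by (simp add: star_star)

lemma star_minus [simp]: "star (- x::'a::cstar_algebra) = - star x"
  using star_add[of x "-x"] by (simp add: add_eq_0_iff)

lemma star_diff: "star (x - y::'a::cstar_algebra) = star x - star y"
  using star_add[of x "-y"] by simp

lemma star_scaleR: "star (r *\<^sub>R x::'a::cstar_algebra) = r *\<^sub>R star x"
  by (simp add: scaleR_eq_scaleC star_scaleC)

lemma star_power: "star (x ^ n::'a::cstar_algebra) = star x ^ n"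
  by (induction n) (simp_all add: star_mult power_Suc2 flip: power_Suc)

lemma norm_star [simp]: "norm (star x) = norm (x::'a::cstar_algebra)"
proof -
  have le: "norm y \<le> norm (star y)" for y :: 'a
  proof (cases "y = 0")
    case False
    have "norm y * norm y \<le> norm (star y) * norm y"
      using norm_mult_ineq[of "star y" y] by (simp add: cstar_identity power2_eq_square)
    with False show ?thesis by simp
  qed simp
  from le[of x] le[of "star x"] show ?thesis by (simp add: star_star)
qed

lemma bounded_linear_star: "bounded_linear (star :: 'a::cstar_algebra \<Rightarrow> 'a)"
  by (rule bounded_linear_intro[where K = 1]) (simp_all add: star_add star_scaleR)

lemma norm_selfadjoint_square:
  "selfadjoint x \<Longrightarrow> norm (x * x) = (norm (x::'a::cstar_algebra))\<^sup>2"
  using cstar_identity[of x] by (simp add: selfadjoint_def)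

lemma norm_selfadjoint_dyadic_power:
  assumes "selfadjoint (x::'a::cstar_algebra)"
  shows "norm (x ^ (2 ^ k)) = norm x ^ (2 ^ k)"
proof (induction k)
  case (Suc k)
  have "selfadjoint (x ^ (2 ^ k))"
    using assms by (simp add: selfadjoint_def star_power)
  then have "norm (x ^ (2 ^ k) * x ^ (2 ^ k)) = (norm (x ^ (2 ^ k)))\<^sup>2"
    by (rule norm_selfadjoint_square)
  moreover have two: "(2::nat) ^ Suc k = 2 ^ k + 2 ^ k" by simp
  ultimately show ?case
    unfolding two power_add Suc.IH power2_eq_square by simp
qed simp

section \<open>Invertible elements and the spectrum\<close>

text \<open>
  Relational, so that the inverse itself is at hand for norm estimates of resolvents; it has to be
  two-sided because the algebra is not commutative.
\<close>

definition inverse_pair :: "'a::monoid_mult \<Rightarrow> 'a \<Rightarrow> bool" where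
  "inverse_pair x y \<longleftrightarrow> x * y = 1 \<and> y * x = 1"

lemma cstar_spectrum_iff:
  "c \<in> cstar_spectrum x \<longleftrightarrow> \<not> (\<exists>y. inverse_pair (c *\<^sub>C 1 - x) y)"
  by (simp add: cstar_spectrum_def inverse_pair_def)

lemma inverse_pair_mult:
  assumes "inverse_pair x x'" "inverse_pair y y'"
  shows "inverse_pair (x * y) (y' * x')"
proof -
  have "x * y * (y' * x') = x * (y * y') * x'" "y' * x' * (x * y) = y' * (x' * x) * y"
    by (simp_all only: mult.assoc)
  with assms show ?thesis by (simp add: inverse_pair_def)
qed

text \<open>
  Commutation makes \<open>y * z\<close> a right inverse and \<open>z * y\<close> a left inverse of \<open>x\<close>, and one-sided
  inverses on both sides coincide.
\<close>

lemma inverse_pair_left_factor: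
  assumes "inverse_pair (x * y) z" "x * y = y * x"
  shows "\<exists>w. inverse_pair x w"
proof -
  have r: "x * (y * z) = 1"
    using assms(1) by (simp add: inverse_pair_def mult.assoc)
  have l: "z * y * x = 1"
    using assms(1) unfolding assms(2) by (simp add: inverse_pair_def mult.assoc)
  have "z * y = z * y * (x * (y * z))" using r by simp
  also have "\<dots> = (z * y * x) * (y * z)" by (simp only: mult.assoc)
  also have "\<dots> = y * z" using l by simp
  finally show ?thesis using r l by (auto simp: inverse_pair_def)
qed

lemma inverse_pair_scaleC:
  assumes "inverse_pair (x::'a::cstar_algebra) y" "c \<noteq> 0"
  shows "inverse_pair (c *\<^sub>C x) (inverse c *\<^sub>C y)"
  using assms by (simp add: inverse_pair_def mult_scaleC_left mult_scaleC_right scaleC_scaleC)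

text \<open>
  The inverse is the Neumann series \<open>\<Sum>n. x ^ n\<close>, which converges absolutely.
\<close>

lemma neumann:
  fixes x :: "'a::{real_normed_algebra_1,banach}"
  assumes "norm x < 1"
  shows "\<exists>y. inverse_pair (1 - x) y"
proof -
  have "summable (\<lambda>n. norm (x ^ n))"
    using assms by (intro summable_comparison_test'[OF summable_geometric[of "norm x"], of 0])
      (simp_all add: norm_power_ineq)
  then have sm: "summable (\<lambda>n. x ^ n)" by (rule summable_norm_cancel)
  define y where "y = (\<Sum>n. x ^ n)"
  have "(\<Sum>n. x ^ Suc n) = y - 1"
    unfolding y_def using suminf_split_head[OF sm] by simp
  moreover have "(\<Sum>n. x ^ Suc n) = x * y" "(\<Sum>n. x ^ Suc n) = y * x"
    using suminf_mult[OF sm, of x] suminf_mult2[OF sm, of x]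
    by (simp_all add: y_def power_Suc2 del: power_Suc) (simp_all add: power_commutes)
  ultimately show ?thesis
    by (intro exI[of _ y]) (simp add: inverse_pair_def algebra_simps)
qed

text \<open>
  The element \<open>x'\<close> factors as \<open>x * (1 - y * (x - x'))\<close>, and the second factor has a Neumann series.
\<close>

lemma inverse_pair_perturb:
  fixes x :: "'a::{real_normed_algebra_1,banach}"
  assumes xy: "inverse_pair x y" and "norm (x - x') * norm y < 1"
  shows "\<exists>y'. inverse_pair x' y'"
proof -
  have "norm (y * (x - x')) \<le> norm y * norm (x - x')" by (rule norm_mult_ineq)
  then have "norm (y * (x - x')) < 1" using assms(2) by (simp add: mult.commute)
  from neumann[OF this] obtain z where "inverse_pair (1 - y * (x - x')) z" by blast
  from inverse_pair_mult[OF xy this] have "inverse_pair (x * (1 - y * (x - x'))) (z * y)" .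
  moreover have "x * (1 - y * (x - x')) = x - (x * y) * (x - x')"
    by (simp add: algebra_simps)
  ultimately show ?thesis using xy by (auto simp: inverse_pair_def)
qed

lemma cmod_le_norm_of_spectrum:
  assumes "c \<in> cstar_spectrum (x::'a::cstar_algebra)"
  shows "cmod c \<le> norm x"
proof (rule ccontr)
  assume "\<not> ?thesis"
  then have lt: "norm x < cmod c" by simp
  then have c0: "c \<noteq> 0" by auto
  have "norm (inverse c *\<^sub>C x) < 1"
    unfolding norm_scaleC norm_inverse using lt c0 by (simp add: inverse_eq_divide)
  from neumann[OF this] obtain y where "inverse_pair (1 - inverse c *\<^sub>C x) y" by blast
  from inverse_pair_scaleC[OF this c0] c0
  have "inverse_pair (c *\<^sub>C 1 - x) (inverse c *\<^sub>C y)"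
    by (simp add: scaleC_diff_right scaleC_scaleC)
  with assms show False by (auto simp: cstar_spectrum_iff)
qed

lemma closed_cstar_spectrum: "closed (cstar_spectrum (x::'a::cstar_algebra))"
proof -
  have "open (- cstar_spectrum x)"
    unfolding open_dist
  proof (intro ballI)
    fix c assume "c \<in> - cstar_spectrum x"
    then obtain y where y: "inverse_pair (c *\<^sub>C 1 - x) y" by (auto simp: cstar_spectrum_iff)
    have "c' \<in> - cstar_spectrum x" if "dist c' c < 1 / (norm y + 1)" for c'
    proof -
      have "cmod (c - c') * norm y \<le> cmod (c - c') * (norm y + 1)"
        by (intro mult_left_mono) auto
      also have "\<dots> < 1"
        using that by (simp add: dist_norm norm_minus_commute pos_less_divide_eq add_nonneg_pos)
      finally have "norm ((c *\<^sub>C 1 - x) - (c' *\<^sub>C 1 - x)) * norm y < 1"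
        by (simp add: norm_scaleC flip: scaleC_diff_left)
      from inverse_pair_perturb[OF y this] show ?thesis by (simp add: cstar_spectrum_iff)
    qed
    moreover have "0 < 1 / (norm y + 1)" by (simp add: add_nonneg_pos)
    ultimately show "\<exists>e>0. \<forall>c'. dist c' c < e \<longrightarrow> c' \<in> - cstar_spectrum x" by blast
  qed
  then show ?thesis by (simp add: closed_def)
qed

lemma compact_cstar_spectrum: "compact (cstar_spectrum (x::'a::cstar_algebra))"
  using closed_cstar_spectrum cmod_le_norm_of_spectrum
  by (auto simp: compact_eq_bounded_closed bounded_iff)

section \<open>Self-adjoint elements attain their norm on the spectrum\<close>

lemma resolvent_identity:
  assumes "inverse_pair (1 - l *\<^sub>C (e::'a::cstar_algebra)) y" "inverse_pair (1 - m *\<^sub>C e) z"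
  shows "y - z = (l - m) *\<^sub>C (y * e * z)"
proof -
  have "y - z = y * ((1 - m *\<^sub>C e) * z) - (y * (1 - l *\<^sub>C e)) * z"
    using assms by (simp add: inverse_pair_def)
  also have "\<dots> = y * (l *\<^sub>C e - m *\<^sub>C e) * z"
    by (simp add: algebra_simps)
  finally show ?thesis
    by (simp add: mult_scaleC_left mult_scaleC_right flip: scaleC_diff_left)
qed

text \<open>
  By the resolvent identity, norms of the resolvent at most double on a small disc around each
  point, and finitely many such discs cover the compact set.
\<close>

lemma bounded_resolvent:
  fixes e :: "'a::cstar_algebra"
  assumes K: "compact K" and R: "\<And>l. l \<in> K \<Longrightarrow> inverse_pair (1 - l *\<^sub>C e) (R l)"
  shows "\<exists>M. \<forall>l\<in>K. norm (R l) \<le> M"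
proof -
  define r where "r l = 1 / (2 * (norm (R l) * norm e + 1))" for l
  have r0: "r l > 0" for l
    unfolding r_def by (intro divide_pos_pos) (auto intro: add_nonneg_pos)
  have local: "norm (R m) \<le> 2 * norm (R l)" if l: "l \<in> K" and m: "m \<in> K" and d: "m \<in> ball l (r l)"
    for l m
  proof -
    have "norm (R m - R l) \<le> cmod (m - l) * (norm (R m) * norm e * norm (R l))"
      unfolding resolvent_identity[OF R[OF m] R[OF l]] norm_scaleC
      by (intro mult_left_mono order_trans[OF norm_mult_ineq] mult_right_mono norm_mult_ineq) auto
    also have "\<dots> = (cmod (m - l) * (norm (R l) * norm e)) * norm (R m)" by (simp add: mult_ac)
    also have "\<dots> \<le> (1/2) * norm (R m)"
    proof (intro mult_right_mono)
      have "cmod (m - l) * (norm (R l) * norm e) \<le> r l * (norm (R l) * norm e + 1)"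
        using d by (intro mult_mono) (auto simp: dist_norm norm_minus_commute r0 less_imp_le)
      also have "\<dots> = 1/2"
        unfolding r_def
        by (metis (no_types, lifting) add_nonneg_pos divide_divide_eq_left' less_irrefl mult_nonneg_nonneg
            nonzero_eq_divide_eq norm_ge_zero times_divide_eq_left mult_1 zero_less_one mult.commute)
      finally show "cmod (m - l) * (norm (R l) * norm e) \<le> 1/2" .
    qed auto
    finally have "norm (R m - R l) \<le> (1/2) * norm (R m)" .
    moreover have "norm (R m) \<le> norm (R m - R l) + norm (R l)"
      using norm_triangle_ineq[of "R m - R l" "R l"] by simp
    ultimately show ?thesis by linarith
  qed
  have "K \<subseteq> (\<Union>l\<in>K. ball l (r l))" using r0 by auto
  then obtain C where C: "C \<subseteq> K" "finite C" "K \<subseteq> (\<Union>l\<in>C. ball l (r l))"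
    using compactE_image[OF K, of K "\<lambda>l. ball l (r l)"] by blast
  have "norm (R m) \<le> (\<Sum>l\<in>C. 2 * norm (R l))" if m: "m \<in> K" for m
  proof -
    obtain l where l: "l \<in> C" "m \<in> ball l (r l)" using C(3) m by blast
    then have "norm (R m) \<le> 2 * norm (R l)" using local[of l m] C(1) m by blast
    also have "\<dots> \<le> (\<Sum>l\<in>C. 2 * norm (R l))"
      using C l by (intro member_le_sum) auto
    finally show ?thesis .
  qed
  then show ?thesis by blast
qed

text \<open>
  Partial fractions: \<open>1 / (1 - x\<^sup>2) = (1 / (1 - x) + 1 / (1 + x)) / 2\<close>.
\<close>

lemma inverse_pair_one_minus_square:
  fixes x :: "'a::cstar_algebra"
  assumes y: "inverse_pair (1 - x) y" and z: "inverse_pair (1 + x) z"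
  shows "inverse_pair (1 - x * x) ((1/2) *\<^sub>R (y + z))"
proof -
  have f: "1 - x * x = (1 + x) * (1 - x)" "1 - x * x = (1 - x) * (1 + x)"
    by (simp_all add: algebra_simps)
  have "(1 - x * x) * y = 1 + x" "(1 - x * x) * z = 1 - x"
    unfolding f(1) using y z f by (simp_all add: inverse_pair_def mult.assoc)
      (metis f(1) f(2) mult.assoc mult.right_neutral)
  moreover have "y * (1 - x * x) = 1 + x" "z * (1 - x * x) = 1 - x"
    unfolding f(2) using y z f by (simp_all add: inverse_pair_def flip: mult.assoc)
      (metis f(1) f(2) mult.assoc mult_1)
  ultimately show ?thesis
    by (simp add: inverse_pair_def distrib_left distrib_right scaleR_2[symmetric])
qed

text \<open>
  Averaging the resolvents at the \<open>2 ^ k\<close>-th roots of unity times \<open>l\<close> inverts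
  \<open>1 - (l e) ^ (2 ^ k)\<close>. An average of rotated copies keeps the Lipschitz constant, so the
  constant does not depend on \<open>k\<close>. Only two terms are averaged per doubling of the exponent:
  \<open>w\<close> below satisfies \<open>w ^ (2 ^ k) = -1\<close>, which turns \<open>1 - x\<close> into \<open>1 + x\<close>.
\<close>

lemma dyadic_resolvent_lipschitz:
  fixes e :: "'a::cstar_algebra"
  assumes R: "\<And>l. cmod l \<le> 1 \<Longrightarrow> inverse_pair (1 - l *\<^sub>C e) (R l)"
    and L: "\<And>l m. cmod l \<le> 1 \<Longrightarrow> cmod m \<le> 1 \<Longrightarrow> norm (R l - R m) \<le> L * cmod (l - m)"
  shows "\<exists>S. (\<forall>l. cmod l \<le> 1 \<longrightarrow> inverse_pair (1 - (l ^ 2 ^ k) *\<^sub>C e ^ 2 ^ k) (S l)) \<and>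
    (\<forall>l m. cmod l \<le> 1 \<longrightarrow> cmod m \<le> 1 \<longrightarrow> norm (S l - S m) \<le> L * cmod (l - m))"
proof (induction k)
  case 0
  show ?case using R L by (intro exI[of _ R]) simp
next
  case (Suc k)
  then obtain S where S: "\<And>l. cmod l \<le> 1 \<Longrightarrow> inverse_pair (1 - (l ^ 2 ^ k) *\<^sub>C e ^ 2 ^ k) (S l)"
    and LS: "\<And>l m. cmod l \<le> 1 \<Longrightarrow> cmod m \<le> 1 \<Longrightarrow> norm (S l - S m) \<le> L * cmod (l - m)"
    by blast
  define w where "w = cis (pi / 2 ^ k)"
  have "w ^ 2 ^ k = cis (real (2 ^ k) * (pi / 2 ^ k))"
    unfolding w_def by (rule Complex.DeMoivre)
  also have "real (2 ^ k) * (pi / 2 ^ k) = pi" by simp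
  finally have w: "cmod w = 1" "w ^ 2 ^ k = -1" by (simp_all add: w_def)
  define S' where "S' l = (1/2) *\<^sub>R (S l + S (w * l))" for l
  show ?case
  proof (intro exI[of _ S'] conjI allI impI)
    fix l :: complex assume l: "cmod l \<le> 1"
    define x where "x = (l ^ 2 ^ k) *\<^sub>C e ^ 2 ^ k"
    have "inverse_pair (1 - x) (S l)" using S[OF l] by (simp add: x_def)
    moreover have "inverse_pair (1 + x) (S (w * l))"
      using S[of "w * l"] l w by (simp add: x_def norm_mult power_mult_distrib)
    ultimately have "inverse_pair (1 - x * x) (S' l)"
      unfolding S'_def by (rule inverse_pair_one_minus_square)
    moreover have "x * x = (l ^ 2 ^ Suc k) *\<^sub>C e ^ 2 ^ Suc k"
      by (simp add: x_def mult_scaleC_left mult_scaleC_right scaleC_scaleC mult_2 power_add)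
    ultimately show "inverse_pair (1 - (l ^ 2 ^ Suc k) *\<^sub>C e ^ 2 ^ Suc k) (S' l)" by simp
  next
    fix l m :: complex assume lm: "cmod l \<le> 1" "cmod m \<le> 1"
    have "S' l - S' m = (1/2) *\<^sub>R ((S l - S m) + (S (w * l) - S (w * m)))"
      by (simp add: S'_def scaleR_add_right scaleR_diff_right)
    then have "norm (S' l - S' m) = (1/2) * norm ((S l - S m) + (S (w * l) - S (w * m)))"
      by simp
    also have "\<dots> \<le> (1/2) * (norm (S l - S m) + norm (S (w * l) - S (w * m)))"
      by (intro mult_left_mono norm_triangle_ineq) simp
    also have "\<dots> \<le> (1/2) * (L * cmod (l - m) + L * cmod (w * l - w * m))"
      using lm w by (intro mult_left_mono add_mono LS) (simp_all add: norm_mult)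
    also have "cmod (w * l - w * m) = cmod (l - m)"
      using w by (simp add: norm_mult flip: right_diff_distrib)
    finally show "norm (S' l - S' m) \<le> L * cmod (l - m)" by simp
  qed
qed

lemma spectrum_scaleR_iff:
  assumes "r \<noteq> 0"
  shows "complex_of_real r * c \<in> cstar_spectrum (r *\<^sub>R x) \<longleftrightarrow> c \<in> cstar_spectrum (x::'a::cstar_algebra)"
proof -
  have key: "inverse_pair (c *\<^sub>C 1 - x) y \<Longrightarrow>
      inverse_pair ((complex_of_real r * c) *\<^sub>C 1 - r *\<^sub>R x) (inverse (complex_of_real r) *\<^sub>C y)"
    if "r \<noteq> 0" for r c y and x :: 'a
    using inverse_pair_scaleC[of "c *\<^sub>C 1 - x" y "complex_of_real r"] that
    by (simp add: scaleC_diff_right scaleC_scaleC scaleR_eq_scaleC)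
  have "complex_of_real (inverse r) * (complex_of_real r * c) = c"
    using assms by (simp add: mult.assoc[symmetric])
  moreover have "inverse r *\<^sub>R r *\<^sub>R x = x" using assms by simp
  ultimately show ?thesis
    using key[of r c x] key[of "inverse r" "complex_of_real r * c" "r *\<^sub>R x"] assms
    unfolding cstar_spectrum_iff by (metis nonzero_imp_inverse_nonzero)
qed

text \<open>
  This is the spectral radius formula without complex analysis. Suppose that the spectrum avoids
  the unit circle. Then \<open>1 - l e\<close> is invertible on the whole closed unit disc, with a resolvent
  that is bounded there by compactness and hence Lipschitz. The previous lemma yields inverses
  \<open>S l\<close> of \<open>1 - (l e) ^ n\<close> for \<open>n = 2 ^ k\<close>, Lipschitz uniformly in \<open>n\<close>. For a real
  \<open>\<mu> < 1\<close> that is fixed close to \<open>1\<close>, \<open>S \<mu>\<close> tends to \<open>1\<close> as \<open>n\<close> grows, so \<open>S 1\<close> is near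
  \<open>1\<close>, which forces \<open>e ^ n\<close> to be small. But the \<open>C\<^sup>*\<close>-identity keeps its norm equal to \<open>1\<close>.
\<close>

lemma unit_selfadjoint_spectrum_meets_circle:
  assumes e: "selfadjoint (e::'a::cstar_algebra)" and ne: "norm e = 1"
  shows "\<exists>c\<in>cstar_spectrum e. cmod c = 1"
proof (rule ccontr)
  assume none: "\<not> ?thesis"
  have "\<exists>y. inverse_pair (1 - l *\<^sub>C e) y" if l: "cmod l \<le> 1" for l
  proof (cases "cmod l = 1")
    case True
    then have l0: "l \<noteq> 0" and "cmod (inverse l) = 1" by (auto simp: norm_inverse)
    with none have "inverse l \<notin> cstar_spectrum e" by blast
    then obtain y where y: "inverse_pair (inverse l *\<^sub>C 1 - e) y"
      unfolding cstar_spectrum_iff by blast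
    from inverse_pair_scaleC[OF y l0] l0 show ?thesis
      by (auto simp: scaleC_diff_right scaleC_scaleC)
  next
    case False
    with l show ?thesis by (intro neumann) (simp add: norm_scaleC ne)
  qed
  then obtain R where R: "\<And>l. cmod l \<le> 1 \<Longrightarrow> inverse_pair (1 - l *\<^sub>C e) (R l)"
    by metis
  have "\<exists>M. \<forall>l\<in>cball 0 1. norm (R l) \<le> M"
    using R by (intro bounded_resolvent[of _ e]) auto
  then obtain M where M: "\<And>l. cmod l \<le> 1 \<Longrightarrow> norm (R l) \<le> M"
    by (metis mem_cball_0)
  have M0: "0 \<le> M" using order_trans[OF norm_ge_zero M[of 0]] by simp
  have "norm (R l - R m) \<le> (M * M) * cmod (l - m)" if "cmod l \<le> 1" "cmod m \<le> 1" for l m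
  proof -
    have "norm (R l * e * R m) \<le> norm (R l) * norm e * norm (R m)"
      by (intro order_trans[OF norm_mult_ineq] mult_right_mono norm_mult_ineq) auto
    also have "\<dots> \<le> M * M" using M that M0 by (auto simp: ne intro!: mult_mono)
    finally have "norm (R l * e * R m) * cmod (l - m) \<le> M * M * cmod (l - m)"
      by (intro mult_right_mono) auto
    then show ?thesis
      unfolding resolvent_identity[OF R[OF that(1)] R[OF that(2)]] norm_scaleC
      by (simp only: mult.commute)
  qed
  note dyadic = dyadic_resolvent_lipschitz[of e R "M * M", OF R this]
  (* The choice of \<mu> makes the Lipschitz bound between \<mu> and 1 at most 1/8; the exponent 2^k is
     then taken so large that \<mu>^(2^k) < 1/9, which puts S \<mu> within 1/8 of 1. *)
  define \<mu> where "\<mu> = 1 - 1 / (8 * (M * M + 1))"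
  have pos: "0 < M * M + 1" using M0 by (simp add: add_nonneg_pos)
  have \<mu>: "0 \<le> \<mu>" "\<mu> < 1"
    using pos M0 by (auto simp: \<mu>_def field_simps)
  have "M * M * (1 - \<mu>) \<le> (M * M + 1) * (1 - \<mu>)"
    using \<mu> by (intro mult_right_mono) auto
  also have "\<dots> = 1/8" using pos by (simp add: \<mu>_def field_simps)
  finally have lip: "M * M * (1 - \<mu>) \<le> 1/8" .
  obtain k where k: "\<mu> ^ k < 1/9"
    using real_arch_pow_inv[of "1/9" \<mu>] \<mu> by auto
  have small: "\<mu> ^ 2 ^ k < 1/9"
  proof -
    have "k \<le> 2 ^ k" by simp
    then have "\<mu> ^ 2 ^ k \<le> \<mu> ^ k" using \<mu> by (intro power_decreasing) auto
    with k show ?thesis by simp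
  qed
  obtain S where S: "\<And>l. cmod l \<le> 1 \<Longrightarrow> inverse_pair (1 - (l ^ 2 ^ k) *\<^sub>C e ^ 2 ^ k) (S l)"
    and LS: "\<And>l m. cmod l \<le> 1 \<Longrightarrow> cmod m \<le> 1 \<Longrightarrow> norm (S l - S m) \<le> M * M * cmod (l - m)"
    using dyadic[of k] by blast
  define f where "f = e ^ 2 ^ k"
  have nf: "norm f = 1" using norm_selfadjoint_dyadic_power[OF e, of k] by (simp add: f_def ne)
  have "norm (S 1 - S (of_real \<mu>)) \<le> M * M * (1 - \<mu>)"
  proof -
    have "cmod (1 - of_real \<mu>) = 1 - \<mu>"
      using \<mu> by (metis abs_of_nonneg diff_ge_0_iff_ge less_imp_le norm_of_real of_real_1 of_real_diff)
    then show ?thesis using LS[of 1 "of_real \<mu>"] \<mu> by simp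
  qed
  then have 1: "norm (S 1 - S (of_real \<mu>)) \<le> 1/8" using lip by linarith
  have 2: "norm (S (of_real \<mu>) - 1) \<le> 1/8"
  proof -
    define v where "v = S (of_real \<mu>) - 1"
    have "inverse_pair (1 - (\<mu> ^ 2 ^ k) *\<^sub>R f) (1 + v)"
      using S[of "of_real \<mu>"] \<mu> by (simp add: v_def f_def scaleR_eq_scaleC)
    then have "v = (\<mu> ^ 2 ^ k) *\<^sub>R (f * (1 + v))"
      by (simp add: inverse_pair_def algebra_simps)
    then have "norm v = \<mu> ^ 2 ^ k * norm (f * (1 + v))"
      using \<mu> by (metis abs_of_nonneg norm_scaleR zero_le_power)
    also have "norm (f * (1 + v)) \<le> norm f * norm (1 + v)" by (rule norm_mult_ineq)
    also have "norm f * norm (1 + v) \<le> 1 + norm v"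
      using norm_triangle_ineq[of 1 v] by (simp add: nf)
    finally have "norm v \<le> \<mu> ^ 2 ^ k * (1 + norm v)"
      using \<mu> by (simp add: mult_left_mono)
    also have "\<dots> \<le> 1/9 * (1 + norm v)" using small by (intro mult_right_mono) auto
    finally show ?thesis by (simp add: v_def)
  qed
  (* On the other hand, (1 - f) (1 + v) = 1 with norm f = 1 keeps S 1 at distance 1/2 from 1. *)
  define v where "v = S 1 - 1"
  have "inverse_pair (1 - f) (1 + v)" using S[of 1] by (simp add: v_def f_def)
  then have "f = (1 - f) * v" by (simp add: inverse_pair_def algebra_simps)
  then have "norm f \<le> norm (1 - f) * norm v" by (metis norm_mult_ineq)
  also have "\<dots> \<le> 2 * norm v"
    using norm_triangle_ineq4[of 1 f] by (intro mult_right_mono) (auto simp: nf)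
  finally have "1/2 \<le> norm v" by (simp add: nf)
  moreover have "norm v \<le> norm (S 1 - S (of_real \<mu>)) + norm (S (of_real \<mu>) - 1)"
    using norm_triangle_ineq[of "S 1 - S (of_real \<mu>)" "S (of_real \<mu>) - 1"] by (simp add: v_def)
  ultimately show False using 1 2 by linarith
qed

lemma norm_attained_on_spectrum:
  assumes "selfadjoint (x::'a::cstar_algebra)"
  shows "\<exists>c\<in>cstar_spectrum x. cmod c = norm x"
proof (cases "x = 0")
  case True
  have "0 \<in> cstar_spectrum (0::'a)" by (simp add: cstar_spectrum_iff inverse_pair_def)
  with True show ?thesis by force
next
  case False
  define e where "e = inverse (norm x) *\<^sub>R x"
  have x: "x = norm x *\<^sub>R e" using False by (simp add: e_def)
  have "selfadjoint e" "norm e = 1"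
    using assms False by (simp_all add: e_def selfadjoint_def star_scaleR)
  from unit_selfadjoint_spectrum_meets_circle[OF this] obtain c where c: "c \<in> cstar_spectrum e" "cmod c = 1"
    by blast
  have "complex_of_real (norm x) * c \<in> cstar_spectrum x"
    using spectrum_scaleR_iff[of "norm x" c e] c False x by simp
  then show ?thesis using c by (intro bexI[of _ "complex_of_real (norm x) * c"]) (auto simp: norm_mult)
qed

section \<open>Monotonicity of the norm on positive elements\<close>

lemma spectrum_shift:
  "c \<in> cstar_spectrum (x + b *\<^sub>C 1) \<longleftrightarrow> c - b \<in> cstar_spectrum (x::'a::cstar_algebra)"
proof -
  have "c *\<^sub>C 1 - (x + b *\<^sub>C 1) = (c - b) *\<^sub>C 1 - x" by (simp add: scaleC_diff_left)
  then show ?thesis by (simp only: cstar_spectrum_iff)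
qed

lemma spectrum_uminus:
  "c \<in> cstar_spectrum (- x) \<longleftrightarrow> - c \<in> cstar_spectrum (x::'a::cstar_algebra)"
  using spectrum_scaleR_iff[of "-1" "-c" x] by simp

lemma norm_in_spectrum_of_positive:
  assumes "cstar_positive (x::'a::cstar_algebra)"
  shows "complex_of_real (norm x) \<in> cstar_spectrum x"
proof -
  obtain c where c: "c \<in> cstar_spectrum x" "cmod c = norm x"
    using norm_attained_on_spectrum assms by (auto simp: cstar_positive_def)
  have "c \<in> \<real>\<^sub>\<ge>\<^sub>0" using c assms by (auto simp: cstar_positive_def)
  then have "c = complex_of_real (cmod c)" by (auto simp: nonneg_Reals_def)
  then show ?thesis using c by simp
qed

text \<open>
  The spectrum of the self-adjoint element on the left is the reflection of that of \<open>x\<close> within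
  the interval from \<open>0\<close> to \<open>norm x\<close>.
\<close>

lemma norm_complement_of_positive:
  assumes "cstar_positive (x::'a::cstar_algebra)"
  shows "norm (norm x *\<^sub>R 1 - x) \<le> norm x"
proof -
  define y where "y = - x + complex_of_real (norm x) *\<^sub>C 1"
  have y: "y = norm x *\<^sub>R 1 - x" by (simp add: y_def scaleR_eq_scaleC)
  have "selfadjoint y"
    using assms by (simp add: y cstar_positive_def selfadjoint_def star_diff star_scaleR)
  then obtain c where c: "c \<in> cstar_spectrum y" "cmod c = norm y"
    using norm_attained_on_spectrum by blast
  have s: "complex_of_real (norm x) - c \<in> cstar_spectrum x"
    using c(1) unfolding y_def spectrum_shift spectrum_uminus by simp
  then have "complex_of_real (norm x) - c \<in> \<real>\<^sub>\<ge>\<^sub>0" using assms by (auto simp: cstar_positive_def)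
  then obtain r where r: "r \<ge> 0" "complex_of_real (norm x) - c = of_real r"
    by (auto simp: nonneg_Reals_def)
  have "r \<le> norm x" using cmod_le_norm_of_spectrum[OF s] r by simp
  moreover have "c = of_real (norm x - r)" using r by (simp add: algebra_simps)
  then have "cmod c = \<bar>norm x - r\<bar>" by (simp only: norm_of_real)
  ultimately show ?thesis using c r by (simp add: y)
qed

text \<open>
  With \<open>t = norm (b - a)\<close>, the number \<open>norm a + t\<close> lies in the spectrum of
  \<open>a + t = b + (t - (b - a))\<close>, and the last summand has norm at most \<open>t\<close>. This bypasses the
  fact that sums of positive elements are positive.
\<close>

lemma norm_mono_of_cstar_le:
  assumes a: "cstar_positive a" and ab: "a \<preceq> (b::'a::cstar_algebra)"
  shows "norm a \<le> norm b"
proof -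
  define t where "t = norm (b - a)"
  have t: "norm (t *\<^sub>R 1 - (b - a)) \<le> t"
    using norm_complement_of_positive[of "b - a"] ab by (simp add: t_def cstar_le_def)
  have "complex_of_real (norm a + t) \<in> cstar_spectrum (a + complex_of_real t *\<^sub>C 1)"
    using norm_in_spectrum_of_positive[OF a] by (simp add: spectrum_shift)
  from cmod_le_norm_of_spectrum[OF this] have "norm a + t \<le> norm (a + t *\<^sub>R 1)"
    by (simp only: norm_of_real scaleR_eq_scaleC)
  also have "a + t *\<^sub>R 1 = b + (t *\<^sub>R 1 - (b - a))" by simp
  also have "norm \<dots> \<le> norm b + t"
    using norm_triangle_ineq[of b "t *\<^sub>R 1 - (b - a)"] t by linarith
  finally show ?thesis by simp
qed

text \<open>
  Translating by \<open>\<i> t\<close> moves \<open>c\<close> to \<open>c + \<i> t\<close>, while the \<open>C\<^sup>*\<close>-identity bounds the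
  squared norm of \<open>x + \<i> t\<close> by \<open>(norm x)\<^sup>2 + t\<^sup>2\<close>. The terms quadratic in \<open>t\<close> cancel, and the
  remaining inequality, linear in \<open>t\<close>, holds for all real \<open>t\<close> only if \<open>Im c = 0\<close>.
\<close>

lemma spectrum_of_selfadjoint_real:
  assumes x: "selfadjoint (x::'a::cstar_algebra)" and c: "c \<in> cstar_spectrum x"
  shows "c \<in> \<real>"
proof -
  have bound: "2 * t * Im c \<le> (norm x)\<^sup>2" for t :: real
  proof -
    define y where "y = x + (\<i> * of_real t) *\<^sub>C 1"
    have "c + \<i> * of_real t \<in> cstar_spectrum y" using c by (simp add: y_def spectrum_shift)
    then have "(cmod (c + \<i> * of_real t))\<^sup>2 \<le> (norm y)\<^sup>2"
      using cmod_le_norm_of_spectrum by (intro power_mono) auto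
    also have "(norm y)\<^sup>2 = norm (star y * y)" by (simp add: cstar_identity)
    also have "star y * y = x * x - (\<i> * of_real t * (\<i> * of_real t)) *\<^sub>C 1"
      using x by (simp add: y_def selfadjoint_def star_add star_scaleC algebra_simps
        mult_scaleC_left mult_scaleC_right scaleC_scaleC scaleC_diff_right)
    also have "\<i> * of_real t * (\<i> * of_real t) = - complex_of_real (t * t)"
      by (simp add: algebra_simps)
    also have "x * x - (- complex_of_real (t * t)) *\<^sub>C 1 = x * x + (t * t) *\<^sub>R 1"
      by (simp add: scaleR_eq_scaleC)
    also have "norm \<dots> \<le> (norm x)\<^sup>2 + t * t"
      using norm_triangle_ineq[of "x * x" "(t * t) *\<^sub>R 1"] norm_selfadjoint_square[OF x] by simp
    finally have "(Re c)\<^sup>2 + (Im c + t)\<^sup>2 \<le> (norm x)\<^sup>2 + t * t" by (simp add: cmod_power2)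
    then have "2 * t * Im c + ((Re c)\<^sup>2 + (Im c)\<^sup>2) \<le> (norm x)\<^sup>2"
      by (simp add: power2_eq_square algebra_simps)
    moreover have "0 \<le> (Re c)\<^sup>2 + (Im c)\<^sup>2" by simp
    ultimately show ?thesis by linarith
  qed
  have "Im c = 0"
  proof (rule ccontr)
    assume "Im c \<noteq> 0"
    (* For this t the left-hand side of the bound is (norm x)^2 + 1. *)
    then show False using bound[of "((norm x)\<^sup>2 + 1) / (2 * Im c)"] by simp
  qed
  then show ?thesis by (simp add: complex_is_Real_iff)
qed

section \<open>Polynomials in an element\<close>

text \<open>
  Horner evaluation, as in the definition of \<open>poly\<close>, of a polynomial with complex coefficients
  at an element of a noncommutative algebra.
\<close>

definition aeval :: "complex poly \<Rightarrow> 'a \<Rightarrow> 'a::cstar_algebra" where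
  "aeval p a = fold_coeffs (\<lambda>c y. c *\<^sub>C 1 + a * y) p 0"

lemma aeval_0 [simp]: "aeval 0 a = 0"
  by (simp add: aeval_def)

lemma aeval_pCons [simp]: "aeval (pCons c p) a = c *\<^sub>C 1 + a * aeval p a"
  by (cases "p = 0 \<and> c = 0") (auto simp: aeval_def)

lemma aeval_1 [simp]: "aeval 1 a = 1"
  by (simp add: one_pCons)

lemma aeval_add: "aeval (p + q) a = aeval p a + aeval q a"
  by (induction p q rule: poly_induct2) (simp_all add: scaleC_add_left algebra_simps)

lemma aeval_smult: "aeval (smult c p) a = c *\<^sub>C aeval p a"
  by (induction p) (simp_all add: scaleC_add_right scaleC_scaleC mult_scaleC_right)

lemma aeval_diff: "aeval (p - q) a = aeval p a - aeval q a"
  using aeval_add[of "p - q" q a] by (simp add: algebra_simps)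

lemma aeval_commute: "a * aeval p a = aeval p a * a"
  by (induction p) (simp_all add: distrib_left distrib_right mult_scaleC_left mult_scaleC_right
      flip: mult.assoc)

lemma aeval_mult: "aeval (p * q) a = aeval p a * aeval q a"
  by (induction p)
    (simp_all add: aeval_add aeval_smult distrib_right mult_scaleC_left mult.assoc)

lemma aeval_map_cnj:
  assumes "selfadjoint a"
  shows "aeval (map_poly cnj p) a = star (aeval p a)"
  using assms
  by (induction p)
    (simp_all add: map_poly_pCons star_add star_scaleC star_mult selfadjoint_def aeval_commute)

lemma poly_map_cnj_real:
  assumes "z \<in> \<real>"
  shows "poly (map_poly cnj p) z = cnj (poly p z)"
  using assms by (induction p) (simp_all add: map_poly_pCons Reals_cnj_iff)

text \<open>
  The polynomial \<open>poly p z - p\<close> has the root \<open>z\<close>, so it is a multiple of \<open>X - z\<close>; if its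
  value at \<open>a\<close> were invertible, so would be the commuting factor \<open>z - a\<close>.
\<close>

lemma poly_in_spectrum:
  assumes "z \<in> cstar_spectrum a"
  shows "poly p z \<in> cstar_spectrum (aeval p a)"
proof (rule ccontr)
  assume "\<not> ?thesis"
  then obtain y where y: "inverse_pair (poly p z *\<^sub>C 1 - aeval p a) y"
    by (auto simp: cstar_spectrum_iff)
  have "poly ([:poly p z:] - p) z = 0" by simp
  then obtain q where q: "[:poly p z:] - p = [:- z, 1:] * q"
    unfolding poly_eq_0_iff_dvd by (auto simp: dvd_def)
  have "poly p z *\<^sub>C 1 - aeval p a = aeval ([:poly p z:] - p) a"
    by (simp add: aeval_diff)
  also have "\<dots> = (z *\<^sub>C 1 - a) * (- aeval q a)"
    unfolding q aeval_mult by (simp add: algebra_simps)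
  finally have "inverse_pair ((z *\<^sub>C 1 - a) * (- aeval q a)) y" using y by simp
  moreover have "(z *\<^sub>C 1 - a) * (- aeval q a) = (- aeval q a) * (z *\<^sub>C 1 - a)"
    by (simp add: algebra_simps aeval_commute mult_scaleC_left mult_scaleC_right)
  ultimately have "\<exists>w. inverse_pair (z *\<^sub>C 1 - a) w"
    by (rule inverse_pair_left_factor)
  with assms show False by (auto simp: cstar_spectrum_iff)
qed

text \<open>
  Over the complex numbers \<open>p\<close> splits into linear factors, and each of them takes an invertible
  value at \<open>a\<close>.
\<close>

lemma inverse_pair_aeval:
  assumes "p \<noteq> 0" "\<And>z. z \<in> cstar_spectrum a \<Longrightarrow> poly p z \<noteq> 0"
  shows "\<exists>y. inverse_pair (aeval p a) y"
  using assms
proof (induction "degree p" arbitrary: p)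
  case 0
  then obtain c where c: "p = [:c:]" "c \<noteq> 0" by (metis degree_eq_zeroE pCons_eq_0_iff)
  have "inverse_pair (1::'a) 1" by (simp add: inverse_pair_def)
  from inverse_pair_scaleC[OF this c(2)] show ?case unfolding c(1) by auto
next
  case (Suc n)
  then have "\<not> constant (poly p)" by (simp add: constant_degree)
  then obtain z where z: "poly p z = 0" using fundamental_theorem_of_algebra by blast
  then obtain q where q: "p = [:- z, 1:] * q"
    unfolding poly_eq_0_iff_dvd by (auto simp: dvd_def)
  have "q \<noteq> 0" using q Suc.prems by auto
  moreover have "degree q = n" using Suc.hyps(2) \<open>q \<noteq> 0\<close> unfolding q
    by (subst (asm) degree_mult_eq) auto
  ultimately obtain y where y: "inverse_pair (aeval q a) y"
    using Suc.hyps(1)[of q] Suc.prems(2) unfolding q by auto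
  have "z \<notin> cstar_spectrum a" using z Suc.prems(2) by auto
  then obtain w where "inverse_pair (z *\<^sub>C 1 - a) w" by (auto simp: cstar_spectrum_iff)
  from inverse_pair_scaleC[OF this, of "-1"] have "inverse_pair (aeval [:- z, 1:] a) (- w)"
    by simp
  from inverse_pair_mult[OF this y] show ?case unfolding q aeval_mult by blast
qed

lemma spectrum_nonempty:
  "selfadjoint (a::'a::cstar_algebra) \<Longrightarrow> cstar_spectrum a \<noteq> {}"
  using norm_attained_on_spectrum by blast

lemma spectrum_aeval_subset:
  assumes "cstar_spectrum a \<noteq> {}"
  shows "cstar_spectrum (aeval p a) \<subseteq> poly p ` cstar_spectrum a"
proof
  fix c assume c: "c \<in> cstar_spectrum (aeval p a)"
  show "c \<in> poly p ` cstar_spectrum a"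
  proof (rule ccontr)
    assume n: "c \<notin> poly p ` cstar_spectrum a"
    then have nz: "\<And>z. z \<in> cstar_spectrum a \<Longrightarrow> poly ([:c:] - p) z \<noteq> 0" by auto
    then have "[:c:] - p \<noteq> 0" using assms by fastforce
    from inverse_pair_aeval[OF this nz] c show False
      by (auto simp: aeval_diff cstar_spectrum_iff)
  qed
qed

text \<open>
  The \<open>C\<^sup>*\<close>-identity reduces the claim to the self-adjoint element \<open>star (aeval p a) * aeval p a\<close>.
  It is the value at \<open>a\<close> of the polynomial \<open>q\<close> below, which equals \<open>\<bar>p\<bar>\<^sup>2\<close> on the real
  spectrum of \<open>a\<close>, so the spectral mapping theorem applies.
\<close>

lemma norm_aeval_attained:
  assumes a: "selfadjoint (a::'a::cstar_algebra)"
  shows "\<exists>z\<in>cstar_spectrum a. norm (aeval p a) = cmod (poly p z)"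
proof -
  define q where "q = map_poly cnj p * p"
  have q: "aeval q a = star (aeval p a) * aeval p a"
    by (simp add: q_def aeval_mult aeval_map_cnj[OF a])
  then have "selfadjoint (aeval q a)" by (simp add: selfadjoint_def star_mult star_star)
  then obtain c where c: "c \<in> cstar_spectrum (aeval q a)" "cmod c = norm (aeval q a)"
    using norm_attained_on_spectrum by blast
  then obtain z where z: "z \<in> cstar_spectrum a" "c = poly q z"
    using spectrum_aeval_subset[OF spectrum_nonempty[OF a]] by blast
  have "z \<in> \<real>" using spectrum_of_selfadjoint_real[OF a] z by blast
  then have "cmod c = (cmod (poly p z))\<^sup>2"
    unfolding z(2) q_def poly_mult
    by (simp only: poly_map_cnj_real norm_mult complex_mod_cnj power2_eq_square)
  moreover have "norm (aeval q a) = (norm (aeval p a))\<^sup>2" by (simp add: q cstar_identity)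
  ultimately have "(norm (aeval p a))\<^sup>2 = (cmod (poly p z))\<^sup>2" using c by simp
  then have "norm (aeval p a) = cmod (poly p z)" by (simp add: power2_eq_iff_nonneg)
  with z show ?thesis by blast
qed

section \<open>The continuous functional calculus of a self-adjoint element\<close>

text \<open>
  The Weierstrass theorem for the real and imaginary parts. On a set of real numbers no
  polynomials in the conjugate are needed.
\<close>

lemma polynomial_approximation_on_reals:
  fixes f :: "complex \<Rightarrow> complex"
  assumes K: "compact K" "K \<subseteq> \<real>" and f: "continuous_on K f" and e: "e > 0"
  shows "\<exists>p. \<forall>z\<in>K. cmod (poly p z - f z) < e"
proof -
  define J where "J = Re ` K"
  have J: "compact J" unfolding J_def by (intro compact_continuous_image continuous_intros K)
  have "of_real ` J \<subseteq> K"
    using K(2) by (auto simp: J_def Reals_def)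
  then have cont: "continuous_on J (\<lambda>x. f (of_real x))"
    by (intro continuous_on_compose2[OF f] continuous_intros)
  have approx: "\<exists>p. \<forall>x\<in>J. cmod (poly p (of_real x) - of_real (g x)) < e / 2"
    if g: "continuous_on J g" for g :: "real \<Rightarrow> real"
  proof -
    obtain h where h: "real_polynomial_function h" "\<And>x. x \<in> J \<Longrightarrow> \<bar>g x - h x\<bar> < e / 2"
      using Stone_Weierstrass_real_polynomial_function[OF J g, of "e / 2"] e by auto
    then obtain c n where c: "h = (\<lambda>x. \<Sum>i\<le>n. c i * x ^ i)"
      unfolding real_polynomial_function_iff_sum by blast
    define p where "p = (\<Sum>i\<le>n. monom (complex_of_real (c i)) i)"
    have "poly p (of_real x) = of_real (h x)" for x
      by (simp add: p_def c poly_sum poly_monom)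
    then have "cmod (poly p (of_real x) - of_real (g x)) = \<bar>g x - h x\<bar>" for x
      by (metis abs_minus_commute norm_of_real of_real_diff)
    then show ?thesis using h by (intro exI[of _ p]) auto
  qed
  obtain p where p: "\<forall>x\<in>J. cmod (poly p (of_real x) - of_real (Re (f (of_real x)))) < e / 2"
    using approx[OF continuous_on_Re[OF cont]] by (elim exE)
  obtain q where q: "\<forall>x\<in>J. cmod (poly q (of_real x) - of_real (Im (f (of_real x)))) < e / 2"
    using approx[OF continuous_on_Im[OF cont]] by (elim exE)
  show ?thesis
  proof (intro exI[of _ "p + smult \<i> q"] ballI)
    fix z assume z: "z \<in> K"
    then obtain x where x: "x \<in> J" "z = of_real x" using K(2) by (force simp: J_def Reals_def)
    have "poly (p + smult \<i> q) z - f z = (poly p z - of_real (Re (f z))) + \<i> * (poly q z - of_real (Im (f z)))"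
      by (simp add: complex_eq_iff)
    also have "cmod \<dots> \<le> cmod (poly p z - of_real (Re (f z))) + cmod (poly q z - of_real (Im (f z)))"
      by (rule order_trans[OF norm_triangle_ineq]) (simp add: norm_mult)
    also have "\<dots> < e" using bspec[OF p x(1)] bspec[OF q x(1)] unfolding x(2) by linarith
    finally show "cmod (poly (p + smult \<i> q) z - f z) < e" .
  qed
qed

lemma poly_fun_eq:
  "poly (p + q) = (\<lambda>z. poly p z + poly q z)" "poly (p * q) = (\<lambda>z. poly p z * poly q z)"
  "poly (smult c p) = (\<lambda>z. c * poly p z)"
  by (simp_all add: fun_eq_iff)

text \<open>
  The graph of the functional calculus, as the closure of the graph of polynomial evaluation.
  Working with a relation lets algebraic properties pass to the limit before existence and
  uniqueness of the value are known.
\<close>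

definition poly_limit :: "'a::cstar_algebra \<Rightarrow> (complex \<Rightarrow> complex) \<Rightarrow> 'a \<Rightarrow> bool" where
  "poly_limit a f y \<longleftrightarrow> (\<exists>p. uniform_limit (cstar_spectrum a) (\<lambda>n. poly (p n)) f sequentially \<and>
     (\<lambda>n. aeval (p n) a) \<longlonglongrightarrow> y)"

lemma poly_limit_poly: "poly_limit a (poly p) (aeval p a)"
  unfolding poly_limit_def by (intro exI[of _ "\<lambda>_. p"]) (auto intro: uniform_limit_const)

lemma poly_limit_cong:
  assumes "\<And>z. z \<in> cstar_spectrum a \<Longrightarrow> f z = g z"
  shows "poly_limit a f y \<longleftrightarrow> poly_limit a g y"
  unfolding poly_limit_def using assms by (auto cong: uniform_limit_cong')

lemma poly_limit_add:
  assumes "poly_limit a f x" "poly_limit a g y"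
  shows "poly_limit a (\<lambda>z. f z + g z) (x + y)"
proof -
  obtain p q where "uniform_limit (cstar_spectrum a) (\<lambda>n. poly (p n)) f sequentially"
    "(\<lambda>n. aeval (p n) a) \<longlonglongrightarrow> x" "uniform_limit (cstar_spectrum a) (\<lambda>n. poly (q n)) g sequentially"
    "(\<lambda>n. aeval (q n) a) \<longlonglongrightarrow> y"
    using assms unfolding poly_limit_def by blast
  then show ?thesis
    unfolding poly_limit_def
    by (intro exI[of _ "\<lambda>n. p n + q n"])
      (auto simp: aeval_add poly_fun_eq intro: uniform_limit_add tendsto_add)
qed

lemma poly_limit_mult:
  assumes "poly_limit a f x" "poly_limit a g y"
    and "continuous_on (cstar_spectrum a) f" "continuous_on (cstar_spectrum a) g"
  shows "poly_limit a (\<lambda>z. f z * g z) (x * y)"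
proof -
  obtain p q where "uniform_limit (cstar_spectrum a) (\<lambda>n. poly (p n)) f sequentially"
    "(\<lambda>n. aeval (p n) a) \<longlonglongrightarrow> x" "uniform_limit (cstar_spectrum a) (\<lambda>n. poly (q n)) g sequentially"
    "(\<lambda>n. aeval (q n) a) \<longlonglongrightarrow> y"
    using assms unfolding poly_limit_def by blast
  moreover have "bounded (f ` cstar_spectrum a)" "bounded (g ` cstar_spectrum a)"
    using assms(3,4) compact_cstar_spectrum compact_continuous_image compact_imp_bounded by blast+
  ultimately show ?thesis
    unfolding poly_limit_def
    by (intro exI[of _ "\<lambda>n. p n * q n"])
      (auto simp: aeval_mult poly_fun_eq intro: uniform_lim_mult tendsto_mult)
qed

lemma poly_limit_star:
  assumes a: "selfadjoint a" and "poly_limit a f x"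
  shows "poly_limit a (\<lambda>z. cnj (f z)) (star x)"
proof -
  obtain p where u: "uniform_limit (cstar_spectrum a) (\<lambda>n. poly (p n)) f sequentially"
    and l: "(\<lambda>n. aeval (p n) a) \<longlonglongrightarrow> x"
    using assms unfolding poly_limit_def by blast
  have "uniform_limit (cstar_spectrum a) (\<lambda>n z. cnj (poly (p n) z)) (\<lambda>z. cnj (f z)) sequentially"
    by (rule bounded_linear.uniform_limit[OF bounded_linear_cnj u])
  moreover have "cnj (poly (p n) z) = poly (map_poly cnj (p n)) z" if "z \<in> cstar_spectrum a" for n z
    by (rule poly_map_cnj_real[OF spectrum_of_selfadjoint_real[OF a that], symmetric])
  ultimately have "uniform_limit (cstar_spectrum a) (\<lambda>n. poly (map_poly cnj (p n))) (\<lambda>z. cnj (f z)) sequentially"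
    by (simp cong: uniform_limit_cong')
  moreover have "(\<lambda>n. aeval (map_poly cnj (p n)) a) \<longlonglongrightarrow> star x"
    unfolding aeval_map_cnj[OF a] by (rule bounded_linear.tendsto[OF bounded_linear_star l])
  ultimately show ?thesis
    unfolding poly_limit_def by (intro exI[of _ "\<lambda>n. map_poly cnj (p n)"] conjI)
qed

lemma poly_limit_norm_le:
  assumes a: "selfadjoint a" and "poly_limit a f x"
    and B: "\<And>z. z \<in> cstar_spectrum a \<Longrightarrow> cmod (f z) \<le> B"
  shows "norm x \<le> B"
proof -
  obtain p where u: "uniform_limit (cstar_spectrum a) (\<lambda>n. poly (p n)) f sequentially"
    and l: "(\<lambda>n. aeval (p n) a) \<longlonglongrightarrow> x"
    using assms unfolding poly_limit_def by blast
  show ?thesis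
  proof (rule field_le_epsilon)
    fix e :: real assume "e > 0"
    from uniform_limitD[OF u this]
    have "\<forall>\<^sub>F n in sequentially. norm (aeval (p n) a) \<le> B + e"
    proof eventually_elim
      case (elim n)
      obtain z where z: "z \<in> cstar_spectrum a" "norm (aeval (p n) a) = cmod (poly (p n) z)"
        using norm_aeval_attained[OF a] by blast
      then show ?case
        using elim B[of z] norm_triangle_ineq2[of "poly (p n) z" "f z"] by (auto simp: dist_norm)
    qed
    then show "norm x \<le> B + e"
      using tendsto_norm[OF l] tendsto_upperbound by (metis trivial_limit_sequentially)
  qed
qed

lemma poly_limit_cmod_le:
  assumes a: "selfadjoint a" and "poly_limit a f x" and z: "z \<in> cstar_spectrum a"
  shows "cmod (f z) \<le> norm x"
proof -
  obtain p where u: "uniform_limit (cstar_spectrum a) (\<lambda>n. poly (p n)) f sequentially"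
    and l: "(\<lambda>n. aeval (p n) a) \<longlonglongrightarrow> x"
    using assms unfolding poly_limit_def by blast
  show ?thesis
  proof (rule tendsto_le[OF trivial_limit_sequentially tendsto_norm[OF l]])
    show "(\<lambda>n. cmod (poly (p n) z)) \<longlonglongrightarrow> cmod (f z)"
      by (intro tendsto_norm tendsto_uniform_limitI[OF u z])
    show "\<forall>\<^sub>F n in sequentially. cmod (poly (p n) z) \<le> norm (aeval (p n) a)"
      using cmod_le_norm_of_spectrum[OF poly_in_spectrum[OF z]] by simp
  qed
qed

lemma poly_limit_scaleC:
  assumes "poly_limit a f y" "continuous_on (cstar_spectrum a) f"
  shows "poly_limit a (\<lambda>z. c * f z) (c *\<^sub>C y)"
proof -
  have "poly_limit a (\<lambda>z. poly [:c:] z * f z) (aeval [:c:] a * y)"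
    by (intro poly_limit_mult poly_limit_poly assms continuous_intros)
  then show ?thesis by (simp add: mult_scaleC_left)
qed

lemma poly_limit_unique:
  assumes a: "selfadjoint a" and f: "continuous_on (cstar_spectrum a) f"
    and x: "poly_limit a f x" and y: "poly_limit a f y"
  shows "x = y"
proof -
  have "norm (x + (- 1) *\<^sub>C y) \<le> 0"
    by (rule poly_limit_norm_le[OF a poly_limit_add[OF x poly_limit_scaleC[OF y f]]]) simp
  then show ?thesis by simp
qed

text \<open>
  Evaluation at \<open>a\<close> is isometric for the supremum norm over the spectrum, so uniformly
  approximating polynomials have a Cauchy sequence of values.
\<close>

lemma poly_limit_exists:
  assumes a: "selfadjoint a" and f: "continuous_on (cstar_spectrum a) f"
  shows "\<exists>y. poly_limit a f y"
proof -
  have "\<exists>p. \<forall>z\<in>cstar_spectrum a. cmod (poly p z - f z) < 1 / Suc n" for n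
    using spectrum_of_selfadjoint_real[OF a]
    by (intro polynomial_approximation_on_reals compact_cstar_spectrum f) auto
  then obtain p where p: "\<And>n z. z \<in> cstar_spectrum a \<Longrightarrow> cmod (poly (p n) z - f z) < 1 / Suc n"
    by metis
  have u: "uniform_limit (cstar_spectrum a) (\<lambda>n. poly (p n)) f sequentially"
  proof (rule uniform_limitI)
    fix e :: real assume e: "e > 0"
    have "\<forall>\<^sub>F n in sequentially. 1 / Suc n < e"
      using order_tendstoD(2)[OF LIMSEQ_inverse_real_of_nat e] by (simp add: inverse_eq_divide)
    then show "\<forall>\<^sub>F n in sequentially. \<forall>z\<in>cstar_spectrum a. dist (poly (p n) z) (f z) < e"
      by eventually_elim (use p in \<open>force simp: dist_norm intro: less_trans\<close>)
  qed
  have "Cauchy (\<lambda>n. aeval (p n) a)"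
  proof (rule metric_CauchyI)
    fix e :: real assume "e > 0"
    then obtain N where N: "1 / Suc N < e / 2" using nat_approx_posE[of "e / 2"] by auto
    have "dist (aeval (p m) a) (aeval (p n) a) < e" if mn: "m \<ge> N" "n \<ge> N" for m n
    proof -
      obtain z where z: "z \<in> cstar_spectrum a"
        "norm (aeval (p m - p n) a) = cmod (poly (p m - p n) z)"
        using norm_aeval_attained[OF a] by blast
      have "cmod (poly (p k) z - f z) < e / 2" if "k \<ge> N" for k
      proof -
        have "1 / real (Suc k) \<le> 1 / real (Suc N)" using that by (intro divide_left_mono) auto
        then show ?thesis using p[OF z(1), of k] N by linarith
      qed
      from this[OF mn(1)] this[OF mn(2)] have "cmod (poly (p m) z - poly (p n) z) < e"
        using norm_triangle_ineq4[of "poly (p m) z - f z" "poly (p n) z - f z"] by simp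
      then show ?thesis using z by (simp add: dist_norm aeval_diff)
    qed
    then show "\<exists>N. \<forall>m\<ge>N. \<forall>n\<ge>N. dist (aeval (p m) a) (aeval (p n) a) < e" by blast
  qed
  then obtain y where "(\<lambda>n. aeval (p n) a) \<longlonglongrightarrow> y" using Cauchy_convergent convergent_def by blast
  with u show ?thesis unfolding poly_limit_def by blast
qed

lemma is_cfc_exists:
  assumes a: "selfadjoint (a::'a::cstar_algebra)"
  shows "\<exists>\<Phi>. is_cfc a \<Phi>"
proof -
  define \<Phi> where "\<Phi> f = (SOME y. poly_limit a f y)" for f
  have lim: "poly_limit a f (\<Phi> f)" if "continuous_on (cstar_spectrum a) f" for f
    unfolding \<Phi>_def using poly_limit_exists[OF a that] by (rule someI_ex)
  have eq: "\<Phi> f = y" if "continuous_on (cstar_spectrum a) f" "poly_limit a f y" for f y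
    using poly_limit_unique[OF a that(1) lim[OF that(1)] that(2)] .
  have "is_cfc a \<Phi>"
    unfolding is_cfc_def Let_def
  proof (intro conjI ballI allI impI; (unfold mem_Collect_eq)?)
    fix f g :: "complex \<Rightarrow> complex"
    assume "continuous_on (cstar_spectrum a) f" "continuous_on (cstar_spectrum a) g"
      and "\<forall>z\<in>cstar_spectrum a. f z = g z"
    then show "\<Phi> f = \<Phi> g" using poly_limit_cong[of a f g] by (intro eq) (auto intro: lim)
  next
    fix f g :: "complex \<Rightarrow> complex"
    assume fg: "continuous_on (cstar_spectrum a) f" "continuous_on (cstar_spectrum a) g"
    show "\<Phi> (\<lambda>z. f z + g z) = \<Phi> f + \<Phi> g"
      by (intro eq poly_limit_add lim continuous_intros fg)
    show "\<Phi> (\<lambda>z. f z * g z) = \<Phi> f * \<Phi> g"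
      by (intro eq poly_limit_mult lim continuous_intros fg)
  next
    fix c and f :: "complex \<Rightarrow> complex" assume f: "continuous_on (cstar_spectrum a) f"
    show "\<Phi> (\<lambda>z. c * f z) = c *\<^sub>C \<Phi> f"
      by (intro eq poly_limit_scaleC lim continuous_intros f)
  next
    fix f :: "complex \<Rightarrow> complex" assume f: "continuous_on (cstar_spectrum a) f"
    show "\<Phi> (\<lambda>z. cnj (f z)) = star (\<Phi> f)"
      by (intro eq poly_limit_star a lim continuous_intros f)
    have bdd: "bdd_above ((\<lambda>z. cmod (f z)) ` cstar_spectrum a)"
      using poly_limit_cmod_le[OF a lim[OF f]] by (auto simp: bdd_above_def)
    show "norm (\<Phi> f) = (SUP z\<in>cstar_spectrum a. cmod (f z))"
    proof (rule antisym)
      show "norm (\<Phi> f) \<le> (SUP z\<in>cstar_spectrum a. cmod (f z))"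
        by (intro poly_limit_norm_le[OF a lim[OF f]] cSUP_upper bdd)
      show "(SUP z\<in>cstar_spectrum a. cmod (f z)) \<le> norm (\<Phi> f)"
        by (intro cSUP_least spectrum_nonempty a poly_limit_cmod_le[OF a lim[OF f]])
    qed
  next
    have one: "poly 1 = (\<lambda>z::complex. 1)" and id: "poly [:0, 1:] = (\<lambda>z::complex. z)"
      by (simp_all add: fun_eq_iff)
    have "poly_limit a (\<lambda>z. 1) 1" using poly_limit_poly[of a 1] unfolding one by simp
    then show "\<Phi> (\<lambda>z. 1) = 1" by (intro eq continuous_intros)
    have "poly_limit a (\<lambda>z. z) a" using poly_limit_poly[of a "[:0, 1:]"] unfolding id by simp
    then show "\<Phi> (\<lambda>z. z) = a" by (intro eq continuous_intros)
  qed
  then show ?thesis by blast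
qed

lemma
  assumes "is_cfc a \<Phi>"
  shows is_cfc_add: "\<lbrakk>continuous_on (cstar_spectrum a) f; continuous_on (cstar_spectrum a) g\<rbrakk>
      \<Longrightarrow> \<Phi> (\<lambda>z. f z + g z) = \<Phi> f + \<Phi> g"
    and is_cfc_mult: "\<lbrakk>continuous_on (cstar_spectrum a) f; continuous_on (cstar_spectrum a) g\<rbrakk>
      \<Longrightarrow> \<Phi> (\<lambda>z. f z * g z) = \<Phi> f * \<Phi> g"
    and is_cfc_scaleC: "continuous_on (cstar_spectrum a) f \<Longrightarrow> \<Phi> (\<lambda>z. c * f z) = c *\<^sub>C \<Phi> f"
    and is_cfc_norm: "continuous_on (cstar_spectrum a) f
      \<Longrightarrow> norm (\<Phi> f) = (SUP z\<in>cstar_spectrum a. cmod (f z))"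
    and is_cfc_one: "\<Phi> (\<lambda>z. 1) = 1"
    and is_cfc_id: "\<Phi> (\<lambda>z. z) = a"
  using assms unfolding is_cfc_def Let_def mem_Collect_eq Ball_def by blast+

lemma is_cfc_poly:
  assumes \<Phi>: "is_cfc a \<Phi>"
  shows "\<Phi> (poly p) = aeval p a"
proof -
  have const: "\<Phi> (\<lambda>z. c) = c *\<^sub>C 1" for c
    using is_cfc_scaleC[OF \<Phi>, of "\<lambda>z. 1" c] is_cfc_one[OF \<Phi>] by simp
  show ?thesis
  proof (induction p)
    case 0
    then show ?case using const[of 0] by (simp add: fun_eq_iff poly_0 [abs_def])
  next
    case (pCons c p)
    have "poly (pCons c p) = (\<lambda>z. c + z * poly p z)" by (simp add: fun_eq_iff)
    then have "\<Phi> (poly (pCons c p)) = \<Phi> (\<lambda>z. c + z * poly p z)" by (simp only:)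
    also have "\<dots> = \<Phi> (\<lambda>z. c) + \<Phi> (\<lambda>z. z * poly p z)"
      by (intro is_cfc_add[OF \<Phi>] continuous_intros)
    also have "\<Phi> (\<lambda>z. z * poly p z) = \<Phi> (\<lambda>z. z) * \<Phi> (poly p)"
      by (intro is_cfc_mult[OF \<Phi>] continuous_intros)
    finally show ?case by (simp add: const is_cfc_id[OF \<Phi>] pCons.IH)
  qed
qed

text \<open>
  An isometric homomorphism that fixes \<open>a\<close> agrees with evaluation on polynomials and hence, by
  density, is determined on all continuous functions.
\<close>

lemma poly_limit_is_cfc:
  assumes a: "selfadjoint (a::'a::cstar_algebra)" and \<Phi>: "is_cfc a \<Phi>"
    and f: "continuous_on (cstar_spectrum a) f"
  shows "poly_limit a f (\<Phi> f)"
proof -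
  obtain p where u: "uniform_limit (cstar_spectrum a) (\<lambda>n. poly (p n)) f sequentially"
    using poly_limit_exists[OF a f] unfolding poly_limit_def by blast
  have "(\<lambda>n. aeval (p n) a) \<longlonglongrightarrow> \<Phi> f"
  proof (rule tendstoI)
    fix e :: real assume "e > 0"
    then have "e / 2 > 0" by simp
    from uniform_limitD[OF u this]
    show "\<forall>\<^sub>F n in sequentially. dist (aeval (p n) a) (\<Phi> f) < e"
    proof eventually_elim
      case (elim n)
      have "\<Phi> (\<lambda>z. poly (p n) z + (- 1) * f z) = \<Phi> (poly (p n)) + \<Phi> (\<lambda>z. (- 1) * f z)"
        by (intro is_cfc_add[OF \<Phi>] continuous_intros f)
      also have "\<Phi> (\<lambda>z. (- 1) * f z) = (- 1) *\<^sub>C \<Phi> f" by (rule is_cfc_scaleC[OF \<Phi> f])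
      finally have "norm (aeval (p n) a - \<Phi> f) = norm (\<Phi> (\<lambda>z. poly (p n) z + (- 1) * f z))"
        by (simp add: is_cfc_poly[OF \<Phi>])
      also have "\<dots> = (SUP z\<in>cstar_spectrum a. cmod (poly (p n) z + (- 1) * f z))"
        by (intro is_cfc_norm[OF \<Phi>] continuous_intros f)
      also have "\<dots> \<le> e / 2"
        using elim by (intro cSUP_least spectrum_nonempty[OF a]) (force simp: dist_norm)
      finally show ?case using \<open>e > 0\<close> by (simp add: dist_norm)
    qed
  qed
  with u show ?thesis unfolding poly_limit_def by blast
qed

lemma poly_limit_cfc:
  assumes a: "selfadjoint (a::'a::cstar_algebra)" and f: "continuous_on (cstar_spectrum a) f"
  shows "poly_limit a f (cfc a f)"
proof -
  obtain \<Phi> where \<Phi>: "is_cfc a \<Phi>" using is_cfc_exists[OF a] by blast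
  have "cfc a f = \<Phi> f"
    unfolding cfc_def
  proof (rule the_equality)
    show "\<exists>\<Psi>. is_cfc a \<Psi> \<and> \<Psi> f = \<Phi> f" using \<Phi> by blast
    show "\<exists>\<Psi>. is_cfc a \<Psi> \<and> \<Psi> f = y \<Longrightarrow> y = \<Phi> f" for y
      using poly_limit_unique[OF a f] poly_limit_is_cfc[OF a _ f] \<Phi> by blast
  qed
  then show ?thesis using poly_limit_is_cfc[OF a \<Phi> f] by simp
qed

lemma norm_cpowr_le:
  assumes a: "cstar_positive (a::'a::cstar_algebra)" and s: "s > 0"
  shows "norm (a cpowr s) \<le> norm a powr s"
proof -
  have sa: "selfadjoint a" using a by (simp add: cstar_positive_def)
  have nonneg: "0 \<le> Re z" "cmod z = Re z" if "z \<in> cstar_spectrum a" for z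
    using a that by (auto simp: cstar_positive_def nonneg_Reals_def)
  have "continuous_on (cstar_spectrum a) (\<lambda>z. complex_of_real (Re z powr s))"
    using nonneg s by (intro continuous_intros continuous_on_powr') auto
  from poly_limit_cfc[OF sa this]
  show ?thesis
    unfolding cstar_powr_def
  proof (rule poly_limit_norm_le[OF sa])
    fix z assume z: "z \<in> cstar_spectrum a"
    show "cmod (complex_of_real (Re z powr s)) \<le> norm a powr s"
      using nonneg[OF z] cmod_le_norm_of_spectrum[OF z] s by (simp add: powr_mono2)
  qed
qed

section \<open>The fixed point theorem\<close>

text \<open>
  Along the orbit \<open>X\<close> of \<open>start\<close>, the displacements \<open>r n = \<rho> (X n) (X (Suc n))\<close> satisfy
  \<open>r (Suc n) powr (1 - \<eta>) \<le> \<tau> * r n powr (\<alpha> + \<beta>)\<close>. As long as \<open>r n \<le> 1\<close>, the condition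
  \<open>\<alpha> + \<beta> > 1 - \<eta>\<close> allows the exponent on the right to be lowered to \<open>1 - \<eta>\<close>, which leaves a
  linear contraction with factor \<open>\<tau> powr (1 / (1 - \<eta>))\<close>; in particular \<open>r\<close> stays below \<open>1\<close>,
  so the argument continues and the orbit is Cauchy. If its limit \<open>z\<close> were moved by \<open>T\<close>, the
  inequality for \<open>X n\<close> and \<open>z\<close> would make the orbit converge to \<open>T z\<close> as well, through the
  vanishing factor \<open>\<rho> (X n) z powr \<alpha>\<close>.
\<close>

lemma fixed_point_of_power_contraction:
  fixes \<rho> :: "'u \<Rightarrow> 'u \<Rightarrow> real"
  assumes nonneg: "\<And>x y. \<lbrakk>x \<in> U; y \<in> U\<rbrakk> \<Longrightarrow> 0 \<le> \<rho> x y"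
    and zero: "\<And>x y. \<lbrakk>x \<in> U; y \<in> U\<rbrakk> \<Longrightarrow> \<rho> x y = 0 \<longleftrightarrow> x = y"
    and commute: "\<And>x y. \<lbrakk>x \<in> U; y \<in> U\<rbrakk> \<Longrightarrow> \<rho> x y = \<rho> y x"
    and triangle: "\<And>x y u. \<lbrakk>x \<in> U; y \<in> U; u \<in> U\<rbrakk> \<Longrightarrow> \<rho> x y \<le> \<rho> x u + \<rho> u y"
    and complete: "\<And>X. \<lbrakk>range X \<subseteq> U; \<forall>e>0. \<exists>N. \<forall>m\<ge>N. \<forall>n\<ge>N. \<rho> (X m) (X n) < e\<rbrakk>
      \<Longrightarrow> \<exists>z\<in>U. (\<lambda>n. \<rho> (X n) z) \<longlonglongrightarrow> 0"
    and T: "T \<in> U \<rightarrow> U" and \<tau>: "0 < \<tau>" "\<tau> < 1"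
    and exps: "0 < \<alpha>" "0 < \<beta>" "0 < \<eta>" "\<eta> < 1" "\<alpha> + \<beta> + \<eta> > 1"
    and contr: "\<And>x y. \<lbrakk>x \<in> U; y \<in> U; x \<noteq> T x; y \<noteq> T y\<rbrakk> \<Longrightarrow>
      \<rho> (T x) (T y) \<le> \<tau> * (\<rho> x y powr \<alpha> * \<rho> x (T x) powr \<beta> * \<rho> y (T y) powr \<eta>)"
    and start: "start \<in> U" "\<rho> start (T start) \<le> 1"
  shows "\<exists>x\<in>U. T x = x"
proof (rule ccontr)
  assume "\<not> ?thesis"
  then have moves: "\<And>x. x \<in> U \<Longrightarrow> x \<noteq> T x" by metis
  have TU: "x \<in> U \<Longrightarrow> T x \<in> U" for x using T by auto
  define X where "X n = (T ^^ n) start" for n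
  have XS: "X (Suc n) = T (X n)" for n by (simp add: X_def)
  have XU: "X n \<in> U" for n by (induction n) (auto simp: XS TU X_def start)
  define r where "r n = \<rho> (X n) (X (Suc n))" for n
  have r_pos: "0 < r n" for n
    using nonneg[OF XU XU, of n "Suc n"] zero[OF XU XU, of n "Suc n"] moves[OF XU, of n]
    by (auto simp: r_def XS less_le)
  define k where "k = \<tau> powr (1 / (1 - \<eta>))"
  have k: "0 < k" "k < 1"
    using \<tau> exps powr_less_mono2[of "1 / (1 - \<eta>)" \<tau> 1] by (auto simp: k_def)
  have step: "r (Suc n) \<le> k * r n" if le1: "r n \<le> 1" for n
  proof -
    have "r (Suc n) \<le> \<tau> * (r n powr \<alpha> * r n powr \<beta> * r (Suc n) powr \<eta>)"
      using contr[OF XU XU moves moves, OF XU XU, of n "Suc n"] by (simp add: r_def XS)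
    also have "\<dots> = \<tau> * r n powr (\<alpha> + \<beta>) * r (Suc n) powr \<eta>"
      by (simp add: powr_add)
    also have "r n powr (\<alpha> + \<beta>) \<le> r n powr (1 - \<eta>)"
      using le1 r_pos[of n] exps by (intro powr_mono') auto
    finally have "r (Suc n) \<le> \<tau> * r n powr (1 - \<eta>) * r (Suc n) powr \<eta>"
      using \<tau> by (simp add: mult_left_mono mult_right_mono)
    then have "r (Suc n) / r (Suc n) powr \<eta> \<le> \<tau> * r n powr (1 - \<eta>)"
      using r_pos[of "Suc n"] by (simp add: pos_divide_le_eq)
    moreover have "r (Suc n) / r (Suc n) powr \<eta> = r (Suc n) powr (1 - \<eta>)"
      using r_pos[of "Suc n"] by (simp add: powr_diff)
    ultimately have "r (Suc n) powr (1 - \<eta>) \<le> \<tau> * r n powr (1 - \<eta>)" by simp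
    then have "(r (Suc n) powr (1 - \<eta>)) powr (1 / (1 - \<eta>)) \<le> (\<tau> * r n powr (1 - \<eta>)) powr (1 / (1 - \<eta>))"
      using exps by (intro powr_mono2) auto
    then show ?thesis
      using exps r_pos[of n] r_pos[of "Suc n"] \<tau> by (simp add: powr_powr powr_mult k_def)
  qed
  have r_le1: "r n \<le> 1" and r_le: "r n \<le> k ^ n" for n
  proof (induction n)
    case 0
    {
      case 1 then show ?case using start by (simp add: r_def X_def)
      case 2 then show ?case using start by (simp add: r_def X_def)
    }
  next
    case (Suc n)
    have "r (Suc n) \<le> k * r n" using step Suc by blast
    also have "k * r n \<le> k * k ^ n" using Suc k by (intro mult_left_mono) auto
    finally have le: "r (Suc n) \<le> k ^ Suc n" by simp
    {
      case 1 then show ?case using le power_le_one[of k "Suc n"] k by linarith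
      case 2 then show ?case by (rule le)
    }
  qed
  have tail: "\<rho> (X n) (X (n + j)) \<le> k ^ n / (1 - k)" for n j
  proof -
    have "\<rho> (X n) (X (n + j)) \<le> (\<Sum>i<j. k ^ (n + i))"
    proof (induction j)
      case 0
      then show ?case using zero[OF XU XU, of n n] by simp
    next
      case (Suc j)
      have "\<rho> (X n) (X (n + Suc j)) \<le> \<rho> (X n) (X (n + j)) + r (n + j)"
        using triangle[OF XU XU XU] by (simp add: r_def)
      then show ?case using Suc r_le[of "n + j"] by simp
    qed
    also have "\<dots> = k ^ n * (\<Sum>i<j. k ^ i)" by (simp add: power_add sum_distrib_left)
    also have "(\<Sum>i<j. k ^ i) = (1 - k ^ j) / (1 - k)" using k by (simp add: sum_gp_strict)
    also have "k ^ n * ((1 - k ^ j) / (1 - k)) \<le> k ^ n * (1 / (1 - k))"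
      using k by (intro mult_left_mono divide_right_mono) auto
    finally show ?thesis by simp
  qed
  have "\<forall>e>0. \<exists>N. \<forall>m\<ge>N. \<forall>n\<ge>N. \<rho> (X m) (X n) < e"
  proof (intro allI impI)
    fix e :: real assume e: "e > 0"
    then obtain N where N: "k ^ N < e * (1 - k) / 2"
      using real_arch_pow_inv[of "e * (1 - k) / 2" k] k by auto
    have "\<rho> (X m) (X n) < e" if "m \<ge> N" "n \<ge> N" for m n
    proof -
      have near: "\<rho> (X N) (X i) \<le> k ^ N / (1 - k)" if "i \<ge> N" for i
        using tail[of N "i - N"] that by simp
      have "\<rho> (X m) (X n) \<le> \<rho> (X N) (X m) + \<rho> (X N) (X n)"
        using triangle[OF XU XU XU, of m n N] commute[OF XU XU, of m N] by simp
      also have "\<dots> \<le> k ^ N / (1 - k) + k ^ N / (1 - k)"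
        using near that by (intro add_mono) auto
      also have "\<dots> < e"
      proof -
        have "k ^ N / (1 - k) < e / 2" using N k by (subst pos_divide_less_eq) auto
        then show ?thesis by linarith
      qed
      finally show ?thesis .
    qed
    then show "\<exists>N. \<forall>m\<ge>N. \<forall>n\<ge>N. \<rho> (X m) (X n) < e" by blast
  qed
  then obtain z where z: "z \<in> U" and lim: "(\<lambda>n. \<rho> (X n) z) \<longlonglongrightarrow> 0"
    using complete[of X] XU by blast
  have bound: "\<rho> z (T z) \<le> \<rho> (X (Suc n)) z + \<tau> * \<rho> (X n) z powr \<alpha> * \<rho> z (T z) powr \<eta>" for n
  proof -
    have "r n powr \<beta> \<le> 1"
      using powr_mono2[of \<beta> "r n" 1] exps r_le1[of n] r_pos[of n] by simp
    have "\<rho> (X (Suc n)) (T z) \<le> \<tau> * (\<rho> (X n) z powr \<alpha> * r n powr \<beta> * \<rho> z (T z) powr \<eta>)"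
      using contr[OF XU z moves[OF XU] moves[OF z], of n] by (simp add: r_def XS)
    also have "\<dots> \<le> \<tau> * (\<rho> (X n) z powr \<alpha> * 1 * \<rho> z (T z) powr \<eta>)"
      using \<tau> \<open>r n powr \<beta> \<le> 1\<close> by (intro mult_left_mono mult_right_mono) auto
    finally show ?thesis
      using triangle[OF z TU[OF z] XU, of "Suc n"] commute[OF z XU, of "Suc n"] by simp
  qed
  have "(\<lambda>n. \<rho> (X n) z powr \<alpha>) \<longlonglongrightarrow> 0"
    using exps nonneg[OF XU z] by (intro tendsto_zero_powrI[OF lim tendsto_const]) auto
  then have "(\<lambda>n. \<tau> * \<rho> (X n) z powr \<alpha> * \<rho> z (T z) powr \<eta>) \<longlonglongrightarrow> 0"
    by (intro tendsto_mult_left_zero tendsto_mult_right_zero)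
  from tendsto_add[OF LIMSEQ_Suc[OF lim] this]
  have "(\<lambda>n. \<rho> (X (Suc n)) z + \<tau> * \<rho> (X n) z powr \<alpha> * \<rho> z (T z) powr \<eta>) \<longlonglongrightarrow> 0" by simp
  from LIMSEQ_le_const[OF this] have "\<rho> z (T z) \<le> 0" using bound by blast
  then show False using nonneg[OF z TU[OF z]] zero[OF z TU[OF z]] moves[OF z] by simp
qed

theorem theorem2p11:
  fixes U :: "'u set"
    and d :: "'u \<Rightarrow> 'u \<Rightarrow> 'a::cstar_algebra"
    and T :: "'u \<Rightarrow> 'u"
    and \<tau> \<alpha> \<beta> \<eta> :: real
  assumes "complete_cstar_metric_space U d"
    and "T \<in> U \<rightarrow> U"
    and "0 < \<tau>" "\<tau> < 1"
    and "0 < \<alpha>" "\<alpha> < 1" "0 < \<beta>" "\<beta> < 1" "0 < \<eta>" "\<eta> < 1"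
    and "\<alpha> + \<beta> + \<eta> > 1"
    and "\<And>x y. \<lbrakk>x \<in> U; y \<in> U; x \<noteq> T x; y \<noteq> T y\<rbrakk> \<Longrightarrow>
           d (T x) (T y) \<preceq>
             \<tau> *\<^sub>R (d x y cpowr \<alpha> * d x (T x) cpowr \<beta> * d y (T y) cpowr \<eta>)"
    and "\<exists>x0\<in>U. d x0 (T x0) \<preceq> 1"
  shows "\<exists>x\<in>U. T x = x"
proof -
  interpret complete_cstar_metric_space U d by fact
  have TU: "x \<in> U \<Longrightarrow> T x \<in> U" for x using assms(2) by auto
  obtain x0 where x0: "x0 \<in> U" "d x0 (T x0) \<preceq> 1" using assms(13) by blast
  show ?thesis
  proof (rule fixed_point_of_power_contraction[where \<rho> = "\<lambda>x y. norm (d x y)" and \<tau> = \<tau>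
        and \<alpha> = \<alpha> and \<beta> = \<beta> and \<eta> = \<eta> and start = x0])
    show "norm (d x y) = 0 \<longleftrightarrow> x = y" if "x \<in> U" "y \<in> U" for x y
      using zero_iff[OF that] by simp
    show "norm (d x y) = norm (d y x)" if "x \<in> U" "y \<in> U" for x y
      using commute[OF that] by simp
    show "norm (d x y) \<le> norm (d x u) + norm (d u y)" if "x \<in> U" "y \<in> U" "u \<in> U" for x y u
      using norm_mono_of_cstar_le[OF positive triangle] norm_triangle_ineq that order_trans by meson
    show "\<exists>z\<in>U. (\<lambda>n. norm (d (X n) z)) \<longlonglongrightarrow> 0"
      if X: "range X \<subseteq> U" and C: "\<forall>e>0. \<exists>N. \<forall>m\<ge>N. \<forall>n\<ge>N. norm (d (X m) (X n)) < e" for X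
    proof -
      have "cauchy_seq X"
        unfolding cauchy_seq_def
      proof (rule tendstoI)
        fix e :: real assume "e > 0"
        with C obtain N where "\<And>m n. m \<ge> N \<Longrightarrow> n \<ge> N \<Longrightarrow> norm (d (X m) (X n)) < e" by meson
        then show "\<forall>\<^sub>F x in sequentially \<times>\<^sub>F sequentially.
            dist (case x of (n, m) \<Rightarrow> norm (d (X n) (X m))) 0 < e"
          by (auto simp: eventually_prod_sequentially intro!: exI[of _ N])
      qed
      from complete[OF X this] show ?thesis by (simp add: converges_to_def)
    qed
    show "norm (d (T x) (T y)) \<le>
        \<tau> * (norm (d x y) powr \<alpha> * norm (d x (T x)) powr \<beta> * norm (d y (T y)) powr \<eta>)"
      if "x \<in> U" "y \<in> U" "x \<noteq> T x" "y \<noteq> T y" for x y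
    proof -
      have "norm (d (T x) (T y)) \<le>
          norm (\<tau> *\<^sub>R (d x y cpowr \<alpha> * d x (T x) cpowr \<beta> * d y (T y) cpowr \<eta>))"
        using that by (intro norm_mono_of_cstar_le positive TU assms)
      also have "\<dots> = \<tau> * norm (d x y cpowr \<alpha> * d x (T x) cpowr \<beta> * d y (T y) cpowr \<eta>)"
        using assms by simp
      also have "\<dots> \<le> \<tau> * (norm (d x y cpowr \<alpha>) * norm (d x (T x) cpowr \<beta>) * norm (d y (T y) cpowr \<eta>))"
        using assms by (intro mult_left_mono order_trans[OF norm_mult_ineq] mult_right_mono norm_mult_ineq) auto
      also have "\<dots> \<le> \<tau> * (norm (d x y) powr \<alpha> * norm (d x (T x)) powr \<beta> * norm (d y (T y)) powr \<eta>)"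
        using assms that by (intro mult_left_mono mult_mono norm_cpowr_le positive TU) auto
      finally show ?thesis .
    qed
    show "norm (d x0 (T x0)) \<le> 1"
      using norm_mono_of_cstar_le[OF positive x0(2)] x0(1) TU by simp
  qed (use assms x0 in auto)
qed

end
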